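(* Let $N=2$, let $\Omega\subset\mathbb{R}^2$ be a bounded, connected open set with Lipschitz boundary, let $\mathcal{L}$ be an equilibrated load functional, and let $\mathcal{V}_0$ be any measurable family of uniformly positive definite quadratic forms (as specified in the context). Then the functional $\mathcal{F}:H^1(\Omega;\mathbb{R}^2)\to\mathbb{R}$, $$\mathcal{F}(\mathbf{v})=\min_{\mathbf{W}\in\mathcal{M}^{2\times 2}_{skew}}\int_\Omega \mathcal{V}_0\Big(\mathbf{x},\,\mathbb{E}(\mathbf{v})-\tfrac12\mathbf{W}^2\Big)\,d\mathbf{x}\;-\;\mathcal{L}(\mathbf{v}),$$ is convex.
   Context: $\mathcal{M}^{N\times N}$, $\mathcal{M}^{N\times N}_{sym}$, $\mathcal{M}^{N\times N}_{skew}$ denote the real, real symmetric and real skew-symmetric $N\times N$ matrices; $|\mathbf{B}|^2=\mathrm{Tr}(\mathbf{B}^T\mathbf{B})$. For $\mathbf{v}\in H^1(\Omega;\mathbb{R}^N)$, $\mathbb{E}(\mathbf{v})=\frac12(\nabla\mathbf{v}^T+\nabla\mathbf{v})$. Quadratic forms: for a.e. $\mathbf{x}\in\Omega$, $\mathcal{V}_0(\mathbf{x},\cdot)$ is a quadratic form on matrices, depending measurably on $\mathbf{x}$, and there are constants $0<\alpha\le\gamma$ independent of $\mathbf{x}$ with $\alpha|\mathbf{B}|^2\le\mathcal{V}_0(\mathbf{x},\mathbf{B})\le\gamma|\mathbf{B}|^2$ for all $\mathbf{B}\in\mathcal{M}^{N\times N}_{sym}$. (Only symmetric arguments occur in $\mathcal{F}$.)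 Load: $\mathcal{L}(\mathbf{v})=\int_{\partial\Omega}\mathbf{f}\cdot\mathbf{v}\,d\mathcal{H}^{N-1}+\int_\Omega\mathbf{g}\cdot\mathbf{v}\,d\mathbf{x}$ with $\mathbf{f}\in L^2(\partial\Omega;\mathbb{R}^N)$, $\mathbf{g}\in L^2(\Omega;\mathbb{R}^N)$. The load is equilibrated: $\mathcal{L}(\mathbf{z})=0$ for every $\mathbf{z}$ with $\mathbb{E}(\mathbf{z})\equiv\mathbf{0}$. The minimum over $\mathbf{W}$ defining $\mathcal{F}(\mathbf{v})$ is attained for every $\mathbf{v}\in H^1(\Omega;\mathbb{R}^N)$. *)

theory Defs
  imports "HOL-Analysis.Analysis"
begin

section \<open>Lipschitz domains and surface measure\<close>

text \<open>Near each boundary point the set is the strict epigraph of a Lipschitz function over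
  the hyperplane orthogonal to some unit vector \<open>e\<close>. The choice of \<open>e\<close> plays the role of the
  usual rotation of coordinates.\<close>

definition lipschitz_boundary :: "'a::euclidean_space set \<Rightarrow> bool" where
  "lipschitz_boundary \<Omega> \<longleftrightarrow>
    (\<forall>p \<in> frontier \<Omega>. \<exists>e r L (\<psi> :: 'a \<Rightarrow> real).
       norm e = 1 \<and> 0 < r \<and> L-lipschitz_on {y. y \<bullet> e = 0} \<psi> \<and>
       (\<forall>x \<in> ball p r. x \<in> \<Omega> \<longleftrightarrow> \<psi> (x - (x \<bullet> e) *\<^sub>R e) < x \<bullet> e))"

text \<open>Covering sets are required to be bounded because \<^const>\<open>diameter\<close> is meaningless otherwise.
  The empty set gets weight 0 also for \<open>k = 0\<close>, where \<open>0 ^ 0 = 1\<close>. The normalisation makes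
  the \<open>k\<close>-dimensional measure agree with \<open>k\<close>-dimensional Lebesgue measure.\<close>

definition hausdorff_weight :: "nat \<Rightarrow> 'a::metric_space set \<Rightarrow> ennreal" where
  "hausdorff_weight k C =
    (if C = {} then 0 else ennreal (unit_ball_vol (real k) * (diameter C / 2) ^ k))"

definition hausdorff_premeasure :: "nat \<Rightarrow> real \<Rightarrow> 'a::metric_space set \<Rightarrow> ennreal" where
  "hausdorff_premeasure k \<delta> A =
    (INF C \<in> {C :: nat \<Rightarrow> 'a set. A \<subseteq> (\<Union>i. C i) \<and> (\<forall>i. bounded (C i) \<and> diameter (C i) \<le> \<delta>)}.
       \<Sum>i. hausdorff_weight k (C i))"

definition hausdorff_outer :: "nat \<Rightarrow> 'a::metric_space set \<Rightarrow> ennreal" where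
  "hausdorff_outer k A = (SUP \<delta> \<in> {0<..}. hausdorff_premeasure k \<delta> A)"

definition hausdorff_measure :: "nat \<Rightarrow> 'a::metric_space measure" where
  "hausdorff_measure k = measure_of UNIV (sets borel) (hausdorff_outer k)"

definition surface_measure :: "(real ^ 'n) set \<Rightarrow> (real ^ 'n) measure" where
  "surface_measure \<Omega> =
    completion (restrict_space (hausdorff_measure (CARD('n) - 1)) (frontier \<Omega>))"


section \<open>Sobolev space of vector fields\<close>

text \<open>Elements of the spaces below are representatives; all notions depend on them only up to
  null sets.\<close>

definition L2_space :: "'a measure \<Rightarrow> ('a \<Rightarrow> 'b::euclidean_space) set" where
  "L2_space M = {f \<in> borel_measurable M. integrable M (\<lambda>x. (norm (f x))\<^sup>2)}"

definition partial_deriv :: "'n \<Rightarrow> (real ^ 'n \<Rightarrow> real) \<Rightarrow> real ^ 'n \<Rightarrow> real" where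
  "partial_deriv j \<phi> x = frechet_derivative \<phi> (at x) (axis j 1)"

fun C_k :: "nat \<Rightarrow> (real ^ 'n \<Rightarrow> real) \<Rightarrow> bool" where
  "C_k 0 \<phi> \<longleftrightarrow> continuous_on UNIV \<phi>"
| "C_k (Suc k) \<phi> \<longleftrightarrow> (\<forall>x. \<phi> differentiable (at x)) \<and> (\<forall>j. C_k k (partial_deriv j \<phi>))"

definition test_functions :: "(real ^ 'n) set \<Rightarrow> (real ^ 'n \<Rightarrow> real) set" where
  "test_functions \<Omega> =
    {\<phi>. (\<forall>k. C_k k \<phi>) \<and> compact (closure {x. \<phi> x \<noteq> 0}) \<and> closure {x. \<phi> x \<noteq> 0} \<subseteq> \<Omega>}"

text \<open>Row \<open>i\<close>, column \<open>j\<close> of the gradient is the weak derivative of component \<open>i\<close> in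
  direction \<open>j\<close>.\<close>

definition has_weak_gradient ::
    "(real ^ 'n) set \<Rightarrow> (real ^ 'n \<Rightarrow> real ^ 'n) \<Rightarrow> (real ^ 'n \<Rightarrow> real ^ 'n ^ 'n) \<Rightarrow> bool" where
  "has_weak_gradient \<Omega> v G \<longleftrightarrow>
    (\<forall>\<phi> \<in> test_functions \<Omega>. \<forall>i j.
       (LINT x|lebesgue_on \<Omega>. v x $ i * partial_deriv j \<phi> x) =
       - (LINT x|lebesgue_on \<Omega>. G x $ i $ j * \<phi> x))"

definition H1 :: "(real ^ 'n) set \<Rightarrow> (real ^ 'n \<Rightarrow> real ^ 'n) set" where
  "H1 \<Omega> = {v \<in> L2_space (lebesgue_on \<Omega>).
            \<exists>G \<in> L2_space (lebesgue_on \<Omega>). has_weak_gradient \<Omega> v G}"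

definition weak_gradient ::
    "(real ^ 'n) set \<Rightarrow> (real ^ 'n \<Rightarrow> real ^ 'n) \<Rightarrow> real ^ 'n \<Rightarrow> real ^ 'n ^ 'n" where
  "weak_gradient \<Omega> v = (SOME G. G \<in> L2_space (lebesgue_on \<Omega>) \<and> has_weak_gradient \<Omega> v G)"

definition sym_gradient ::
    "(real ^ 'n) set \<Rightarrow> (real ^ 'n \<Rightarrow> real ^ 'n) \<Rightarrow> real ^ 'n \<Rightarrow> real ^ 'n ^ 'n" where
  "sym_gradient \<Omega> v x = (1/2) *\<^sub>R (transpose (weak_gradient \<Omega> v x) + weak_gradient \<Omega> v x)"

text \<open>The trace operator is the bounded linear map from \<^const>\<open>H1\<close> to the square integrable
  fields on the boundary that extends restriction of fields continuous up to the boundary.\<close>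

definition is_trace_operator ::
    "(real ^ 'n) set \<Rightarrow> ((real ^ 'n \<Rightarrow> real ^ 'n) \<Rightarrow> real ^ 'n \<Rightarrow> real ^ 'n) \<Rightarrow> bool" where
  "is_trace_operator \<Omega> T \<longleftrightarrow>
    (\<forall>v \<in> H1 \<Omega>. T v \<in> L2_space (surface_measure \<Omega>)) \<and>
    (\<forall>u \<in> H1 \<Omega>. \<forall>v \<in> H1 \<Omega>. \<forall>a b. AE x in surface_measure \<Omega>.
       T (\<lambda>y. a *\<^sub>R u y + b *\<^sub>R v y) x = a *\<^sub>R T u x + b *\<^sub>R T v x) \<and>
    (\<exists>C. \<forall>v \<in> H1 \<Omega>. (LINT x|surface_measure \<Omega>. (norm (T v x))\<^sup>2) \<le>
       C * ((LINT x|lebesgue_on \<Omega>. (norm (v x))\<^sup>2) +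
            (LINT x|lebesgue_on \<Omega>. (norm (weak_gradient \<Omega> v x))\<^sup>2))) \<and>
    (\<forall>v \<in> H1 \<Omega>. continuous_on (closure \<Omega>) v \<longrightarrow> (AE x in surface_measure \<Omega>. T v x = v x))"

text \<open>For a bounded open set with Lipschitz boundary, the trace theorem gives existence of such
  an operator, and density of fields smooth up to the boundary gives uniqueness up to null sets.
  The zero field in the other branch is only a default for sets without a trace operator.\<close>

definition boundary_trace ::
    "(real ^ 'n) set \<Rightarrow> (real ^ 'n \<Rightarrow> real ^ 'n) \<Rightarrow> real ^ 'n \<Rightarrow> real ^ 'n" where
  "boundary_trace \<Omega> =
    (if \<exists>T. is_trace_operator \<Omega> T then SOME T. is_trace_operator \<Omega> T else (\<lambda>v x. 0))"


section \<open>Loads, energy densities and the limit functional\<close>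

definition load ::
    "(real ^ 'n) set \<Rightarrow> (real ^ 'n \<Rightarrow> real ^ 'n) \<Rightarrow> (real ^ 'n \<Rightarrow> real ^ 'n) \<Rightarrow>
     (real ^ 'n \<Rightarrow> real ^ 'n) \<Rightarrow> real" where
  "load \<Omega> f g v = (LINT x|surface_measure \<Omega>. f x \<bullet> boundary_trace \<Omega> v x) +
                  (LINT x|lebesgue_on \<Omega>. g x \<bullet> v x)"

definition equilibrated ::
    "(real ^ 'n) set \<Rightarrow> ((real ^ 'n \<Rightarrow> real ^ 'n) \<Rightarrow> real) \<Rightarrow> bool" where
  "equilibrated \<Omega> \<L> \<longleftrightarrow>
    (\<forall>z \<in> H1 \<Omega>. (AE x in lebesgue_on \<Omega>. sym_gradient \<Omega> z x = 0) \<longrightarrow> \<L> z = 0)"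

definition quadratic_form :: "('a::real_vector \<Rightarrow> real) \<Rightarrow> bool" where
  "quadratic_form q \<longleftrightarrow> (\<exists>b. bilinear b \<and> (\<forall>A. q A = b A A))"

definition frobenius_sq :: "real ^ 'n ^ 'n \<Rightarrow> real" where
  "frobenius_sq B = trace (transpose B ** B)"

definition elastic_density ::
    "(real ^ 'n) set \<Rightarrow> real \<Rightarrow> real \<Rightarrow> (real ^ 'n \<Rightarrow> real ^ 'n ^ 'n \<Rightarrow> real) \<Rightarrow> bool" where
  "elastic_density \<Omega> \<alpha> \<gamma> V0 \<longleftrightarrow>
    (\<forall>B. (\<lambda>x. V0 x B) \<in> borel_measurable (lebesgue_on \<Omega>)) \<and>
    (AE x in lebesgue_on \<Omega>. quadratic_form (V0 x) \<and>
       (\<forall>B. transpose B = B \<longrightarrow>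
          \<alpha> * frobenius_sq B \<le> V0 x B \<and> V0 x B \<le> \<gamma> * frobenius_sq B))"

text \<open>\<open>LEAST\<close> expresses the minimum of a set of reals.\<close>

definition limit_functional ::
    "(real ^ 'n) set \<Rightarrow> (real ^ 'n \<Rightarrow> real ^ 'n ^ 'n \<Rightarrow> real) \<Rightarrow>
     ((real ^ 'n \<Rightarrow> real ^ 'n) \<Rightarrow> real) \<Rightarrow> (real ^ 'n \<Rightarrow> real ^ 'n) \<Rightarrow> real" where
  "limit_functional \<Omega> V0 \<L> v =
    (LEAST e. \<exists>W. transpose W = - W \<and>
       e = (LINT x|lebesgue_on \<Omega>. V0 x (sym_gradient \<Omega> v x - (1/2) *\<^sub>R (W ** W)))) - \<L> v"

text \<open>The library's \<^const>\<open>convex_on\<close> needs a real vector space type, which function types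
  are not; this is its analogue for pointwise convex combinations.\<close>

definition convex_functional_on ::
    "('a \<Rightarrow> 'b::real_vector) set \<Rightarrow> (('a \<Rightarrow> 'b) \<Rightarrow> real) \<Rightarrow> bool" where
  "convex_functional_on S F \<longleftrightarrow>
    (\<forall>u \<in> S. \<forall>v \<in> S. \<forall>t \<in> {0..1}.
       (\<lambda>x. (1 - t) *\<^sub>R u x + t *\<^sub>R v x) \<in> S \<and>
       F (\<lambda>x. (1 - t) *\<^sub>R u x + t *\<^sub>R v x) \<le> (1 - t) * F u + t * F v)"

end

theory Submission
  imports Defs
begin

text \<open>The square of a skew \<open>2 \<times> 2\<close> matrix \<open>W\<close> is \<open>- w\<^sup>2 I\<close> with \<open>w\<close> the off-diagonal entry. The
  minimum over \<open>W\<close> is thus a minimum over \<open>s \<ge> 0\<close> of the integral of \<open>V0 x (E v x + s I)\<close>, which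
  is jointly convex in \<open>(v, s)\<close>; partial minimisation over the convex set of all \<open>s \<ge> 0\<close> preserves
  convexity. The minimum is attained because the integral is a nonnegative quadratic polynomial in
  \<open>s\<close>. That \<open>E v\<close> depends linearly on \<open>v\<close> almost everywhere rests on uniqueness of weak
  gradients.\<close>

section \<open>Smooth bump functions\<close>

lemma partial_deriv_eq:
  "(\<phi> has_derivative D) (at x) \<Longrightarrow> partial_deriv j \<phi> x = D (axis j 1)"
  unfolding partial_deriv_def using frechet_derivative_at by metis

lemma C_k_const: "C_k k (\<lambda>x :: real ^ 'n. c)"
proof (induction k arbitrary: c)
  case (Suc k)
  have "partial_deriv j (\<lambda>x :: real ^ 'n. c) = (\<lambda>x. 0)" for j
    by (rule ext) (simp add: partial_deriv_def)
  with Suc[of 0] show ?case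
    by simp
qed simp

lemma C_k_Suc_imp: "C_k (Suc k) \<phi> \<Longrightarrow> C_k k \<phi>"
proof (induction k arbitrary: \<phi>)
  case 0
  then show ?case
    by (auto intro: continuous_at_imp_continuous_on differentiable_imp_continuous_within)
next
  case (Suc k)
  then show ?case
    by (metis C_k.simps(2))
qed

lemma C_k_add: "C_k k \<phi> \<Longrightarrow> C_k k \<psi> \<Longrightarrow> C_k k (\<lambda>x. \<phi> x + \<psi> x)"
proof (induction k arbitrary: \<phi> \<psi>)
  case 0
  then show ?case
    by (simp add: continuous_on_add)
next
  case (Suc k)
  have d: "\<phi> differentiable (at x)" "\<psi> differentiable (at x)" for x
    using Suc.prems by auto
  have *: "((\<lambda>x. \<phi> x + \<psi> x) has_derivative
      (\<lambda>h. frechet_derivative \<phi> (at x) h + frechet_derivative \<psi> (at x) h)) (at x)" for x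
    using d[THEN frechet_derivative_works[THEN iffD1]] by (rule has_derivative_add)
  have "partial_deriv j (\<lambda>x. \<phi> x + \<psi> x) = (\<lambda>x. partial_deriv j \<phi> x + partial_deriv j \<psi> x)" for j
    using partial_deriv_eq[OF *] differentiableI[OF *]
    by (auto simp: partial_deriv_def)
  with Suc differentiableI[OF *] show ?case
    by simp
qed

lemma C_k_mult: "C_k k \<phi> \<Longrightarrow> C_k k \<psi> \<Longrightarrow> C_k k (\<lambda>x. \<phi> x * \<psi> x)"
proof (induction k arbitrary: \<phi> \<psi>)
  case 0
  then show ?case
    by (simp add: continuous_on_mult)
next
  case (Suc k)
  have d: "\<phi> differentiable (at x)" "\<psi> differentiable (at x)" for x
    using Suc.prems by auto
  have *: "((\<lambda>x. \<phi> x * \<psi> x) has_derivative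
      (\<lambda>h. \<phi> x * frechet_derivative \<psi> (at x) h + frechet_derivative \<phi> (at x) h * \<psi> x)) (at x)" for x
    using d[THEN frechet_derivative_works[THEN iffD1]] by (rule has_derivative_mult)
  have "partial_deriv j (\<lambda>x. \<phi> x * \<psi> x)
      = (\<lambda>x. \<phi> x * partial_deriv j \<psi> x + partial_deriv j \<phi> x * \<psi> x)" for j
    using partial_deriv_eq[OF *] differentiableI[OF *]
    by (auto simp: partial_deriv_def)
  \<comment> \<open>Each summand pairs an undifferentiated factor, which is
    \<open>C_k (Suc k)\<close>, with a derivative that is only \<open>C_k k\<close>; lowering the
    former by \<open>C_k_Suc_imp\<close> lets the induction hypothesis apply.\<close>
  moreover have "C_k k (\<lambda>x. \<phi> x * partial_deriv j \<psi> x + partial_deriv j \<phi> x * \<psi> x)" for j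
    using Suc C_k_Suc_imp[of k] by (intro C_k_add Suc.IH) auto
  ultimately show ?case
    using differentiableI[OF *] by simp
qed

lemma C_k_prod:
  "(\<And>i. i \<in> I \<Longrightarrow> C_k k (\<phi> i)) \<Longrightarrow> C_k k (\<lambda>x. \<Prod>i\<in>I. \<phi> i x)"
  by (induction I rule: infinite_finite_induct) (auto intro: C_k_const C_k_mult)

text \<open>Reduces smoothness in several variables to a chain of one-variable derivatives
  \<open>H\<close>. Both \<open>c\<close> and \<open>k\<close> vary in the induction:
  differentiating moves \<open>k\<close> to \<open>Suc k\<close> and puts the chain rule factor
  \<open>s * axis j 1 $ i\<close> into the scalar.\<close>

lemma C_k_ridge:
  assumes H: "\<And>k t. (H k has_real_derivative H (Suc k) t) (at t)"
  shows "C_k m (\<lambda>x. c * H k (s * x $ i + a))"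
proof (induction m arbitrary: c k)
  case 0
  have "continuous_on UNIV (H k)"
    using H by (meson DERIV_continuous continuous_at_imp_continuous_on)
  then have "continuous_on UNIV (H k \<circ> (\<lambda>x. s * x $ i + a))"
    by (intro continuous_on_compose continuous_intros) (auto intro: continuous_on_subset)
  then show ?case
    by (auto intro: continuous_intros simp: o_def)
next
  case (Suc m)
  have *: "((\<lambda>x. c * H k (s * x $ i + a)) has_derivative
      (\<lambda>h. c * (s * h $ i * H (Suc k) (s * x $ i + a)))) (at x)" for x
    by (rule derivative_eq_intros bounded_linear.has_derivative[OF bounded_linear_vec_nth]
      DERIV_compose_FDERIV[OF H] refl | simp)+
  have "partial_deriv j (\<lambda>x. c * H k (s * x $ i + a))
      = (\<lambda>x. (c * s * axis j 1 $ i) * H (Suc k) (s * x $ i + a))" for j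
    using partial_deriv_eq[OF *] by (auto simp: algebra_simps)
  with Suc differentiableI[OF *] show ?case
    by simp
qed

section \<open>Flat functions built from exp(-1/t), and bumps on boxes\<close>

definition exp_recip :: "real poly \<Rightarrow> real \<Rightarrow> real" where
  "exp_recip p t = (if 0 < t then poly p (1 / t) * exp (- (1 / t)) else 0)"

text \<open>With y = 1/t this is the flatness of \<open>exp_recip p\<close> at 0 from the
  right.\<close>

lemma poly_exp_tendsto_0: "((\<lambda>y. poly p y * exp (- y)) \<longlongrightarrow> (0::real)) at_top"
proof -
  have "((\<lambda>y. coeff p i * (y ^ i / exp y)) \<longlongrightarrow> coeff p i * 0) at_top" for i
    by (intro tendsto_intros tendsto_power_div_exp_0)
  then have "((\<lambda>y. \<Sum>i\<le>degree p. coeff p i * (y ^ i / exp y)) \<longlongrightarrow> (\<Sum>i\<le>degree p. 0)) at_top"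
    by (intro tendsto_sum) auto
  then show ?thesis
    by (simp add: poly_altdef exp_minus divide_inverse sum_distrib_right mult.assoc)
qed

text \<open>The family \<^const>\<open>exp_recip\<close> is closed under differentiation, so each member is smooth.\<close>

lemma exp_recip_has_derivative:
  "(exp_recip p has_real_derivative exp_recip ([:0, 0, 1:] * (p - pderiv p)) t) (at t)"
proof -
  consider "t < 0" | "t = 0" | "0 < t" by linarith
  then show ?thesis
  proof cases
    case 1
    have "((\<lambda>t. 0) has_real_derivative 0) (at t)" by simp
    then have "(exp_recip p has_real_derivative 0) (at t)"
      by (rule has_field_derivative_transform_within_open[where S="{..<0}"])
        (use 1 in \<open>auto simp: exp_recip_def\<close>)
    then show ?thesis
      using 1 by (simp add: exp_recip_def)
  next
    case 3
    \<comment> \<open>Differentiating p(1/t) and exp(-1/t) produces -1/t^2 and 1/t^2 respectively,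
      hence the common factor \<open>[:0, 0, 1:]\<close> and the difference
      \<open>p - pderiv p\<close>.\<close>
    have "((\<lambda>t. poly p (1 / t) * exp (- (1 / t))) has_real_derivative
        poly ([:0, 0, 1:] * (p - pderiv p)) (1 / t) * exp (- (1 / t))) (at t)"
      using 3
      by (auto intro!: derivative_eq_intros DERIV_chain'[where g="poly p", OF _ poly_DERIV]
        simp: field_simps power2_eq_square)
    then have "(exp_recip p has_real_derivative
        poly ([:0, 0, 1:] * (p - pderiv p)) (1 / t) * exp (- (1 / t))) (at t)"
      by (rule has_field_derivative_transform_within_open[where S="{0<..}"])
        (use 3 in \<open>auto simp: exp_recip_def\<close>)
    then show ?thesis
      using 3 by (simp add: exp_recip_def)
  next
    case 2
    \<comment> \<open>From the right, the difference quotient at 0 carries an extra 1/h, which is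
      absorbed into the polynomial as the factor \<open>[:0, 1:]\<close>. From the left the quotient
      vanishes.\<close>
    have "((\<lambda>h. poly ([:0, 1:] * p) (inverse h) * exp (- inverse h)) \<longlongrightarrow> 0) (at_right 0)"
      by (rule filterlim_compose[OF poly_exp_tendsto_0 filterlim_inverse_at_top_right])
    then have "((\<lambda>h. exp_recip p h / h) \<longlongrightarrow> 0) (at_right 0)"
      by (rule Lim_transform_eventually)
        (auto simp: eventually_at_filter exp_recip_def divide_inverse mult_ac)
    moreover have "((\<lambda>h. exp_recip p h / h) \<longlongrightarrow> 0) (at_left 0)"
      by (rule Lim_transform_eventually[OF tendsto_const])
        (auto simp: eventually_at_filter exp_recip_def)
    ultimately have "((\<lambda>h. exp_recip p h / h) \<longlongrightarrow> 0) (at 0)"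
      by (simp add: filterlim_at_split)
    then show ?thesis
      using 2 by (simp add: DERIV_def exp_recip_def)
  qed
qed

text \<open>For s > 0 each pair of factors is positive exactly when coordinate i lies strictly
  between the two corners. The parameter s is a steepness: as it grows, the values inside the box
  tend to 1.\<close>

definition box_bump :: "real \<Rightarrow> real ^ 'n \<Rightarrow> real ^ 'n \<Rightarrow> real ^ 'n \<Rightarrow> real" where
  "box_bump s a b x =
    (\<Prod>i\<in>UNIV. exp_recip 1 (s * (x $ i - a $ i)) * exp_recip 1 (s * (b $ i - x $ i)))"

lemma exp_recip_1_bounds: "0 \<le> exp_recip 1 t" "exp_recip 1 t \<le> 1"
  by (auto simp: exp_recip_def)

lemma C_k_box_bump: "C_k k (box_bump s a b)"
proof -
  \<comment> \<open>Iterating the derivative rule on the polynomial gives the chain of derivatives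
    that \<open>C_k_ridge\<close> asks for, starting at \<open>exp_recip 1\<close>.\<close>
  define H where "H k = exp_recip (((\<lambda>p. [:0, 0, 1:] * (p - pderiv p)) ^^ k) 1)" for k
  have H: "(H k has_real_derivative H (Suc k) t) (at t)" for k t
    unfolding H_def using exp_recip_has_derivative by simp
  have "C_k k (\<lambda>x. \<Prod>i\<in>UNIV. (1 * H 0 (s * x $ i + (- s * a $ i))) * (1 * H 0 (- s * x $ i + s * b $ i)))"
    by (intro C_k_prod C_k_mult C_k_ridge H)
  then show ?thesis
    by (simp add: H_def box_bump_def[abs_def] algebra_simps)
qed

lemma box_bump_nonzero_iff:
  assumes "0 < s"
  shows "box_bump s a b x \<noteq> 0 \<longleftrightarrow> x \<in> box a b"
  using assms by (auto simp: box_bump_def mem_box_cart exp_recip_def zero_less_mult_iff)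

lemma abs_box_bump_le_1: "\<bar>box_bump s a b x\<bar> \<le> 1"
  unfolding box_bump_def abs_prod abs_mult
  by (intro prod_le_1 conjI) (auto intro!: mult_le_one simp: exp_recip_1_bounds abs_of_nonneg)

lemma box_bump_in_test_functions:
  assumes "0 < s" and "cbox a b \<subseteq> \<Omega>"
  shows "box_bump s a b \<in> test_functions \<Omega>"
proof -
  have "{x. box_bump s a b x \<noteq> 0} = box a b"
    using box_bump_nonzero_iff[OF assms(1)] by blast
  moreover have "closure (box a b) \<subseteq> cbox a b"
    by (simp add: box_subset_cbox closure_minimal closed_cbox)
  ultimately show ?thesis
    using assms(2) C_k_box_bump unfolding test_functions_def by (auto simp: compact_closure)
qed

text \<open>Inside the box every factor is exp(-1/(s t)) with t > 0, which tends to 1 as s grows;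
  outside, all terms are 0. The index \<open>Suc n\<close> keeps the steepness positive.\<close>

lemma box_bump_tendsto_indicator:
  fixes a b x :: "real ^ 'n"
  shows "(\<lambda>n. box_bump (real (Suc n)) a b x) \<longlonglongrightarrow> indicator (box a b) x"
proof (cases "x \<in> box a b")
  case True
  have lim: "(\<lambda>n. exp_recip 1 (real (Suc n) * t)) \<longlonglongrightarrow> 1" if "0 < t" for t :: real
  proof -
    have "(\<lambda>n. exp (- (inverse (real (Suc n)) * inverse t))) \<longlonglongrightarrow> exp (- (0 * inverse t))"
      by (intro tendsto_intros LIMSEQ_inverse_real_of_nat)
    with that show ?thesis
      by (simp add: exp_recip_def divide_inverse)
  qed
  have "(\<lambda>n. box_bump (real (Suc n)) a b x) \<longlonglongrightarrow> (\<Prod>i\<in>(UNIV :: 'n set). 1 * 1)"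
    unfolding box_bump_def by (intro tendsto_prod tendsto_mult lim) (use True in \<open>auto simp: mem_box_cart\<close>)
  with True show ?thesis
    by simp
next
  case False
  then have "box_bump (real (Suc n)) a b x = 0" for n
    using box_bump_nonzero_iff[of "real (Suc n)"] by fastforce
  with False show ?thesis
    by simp
qed

section \<open>Integrable functions orthogonal to all test functions\<close>

text \<open>The bump functions converge boundedly to indicators of boxes, so all box averages of \<open>G\<close>
  vanish and Lebesgue differentiation gives \<open>G = 0\<close> almost everywhere; no mollification is needed.\<close>

lemma fundamental_lemma_calculus_of_variations:
  fixes G :: "real ^ 'n \<Rightarrow> real"
  assumes "open \<Omega>" and G: "integrable (lebesgue_on \<Omega>) G"
    and test: "\<And>\<phi>. \<phi> \<in> test_functions \<Omega> \<Longrightarrow> (LINT x|lebesgue_on \<Omega>. G x * \<phi> x) = 0"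
  shows "AE x in lebesgue_on \<Omega>. G x = 0"
proof -
  have \<Omega>: "\<Omega> \<in> sets lebesgue"
    using \<open>open \<Omega>\<close> by simp
  \<comment> \<open>The differentiation theorem used below wants integrability on every box, so
    \<open>G\<close> is extended by zero outside \<Omega>.\<close>
  define F where "F x = (if x \<in> \<Omega> then G x else 0)" for x
  have F: "integrable lebesgue F"
    unfolding F_def using G \<Omega> by (simp add: Lebesgue_Measure.integrable_restrict_UNIV)
  have F_on: "integrable (lebesgue_on S) F" if "S \<in> sets lebesgue" for S
    using that integrable_mult_indicator[OF that F] by (subst integrable_restrict_space) auto
  have indicator: "(LINT x|lebesgue_on \<Omega>. G x * indicator (box a b) x) = 0" if ab: "cbox a b \<subseteq> \<Omega>" for a b
  proof -
    have bump: "box_bump (real (Suc n)) a b \<in> test_functions \<Omega>" for n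
      using ab by (intro box_bump_in_test_functions) auto
    have cont: "continuous_on UNIV (box_bump (real (Suc n)) a b)" for n
      using C_k_box_bump[of 0] by simp
    have "(\<lambda>n. LINT x|lebesgue_on \<Omega>. G x * box_bump (real (Suc n)) a b x)
        \<longlonglongrightarrow> (LINT x|lebesgue_on \<Omega>. G x * indicator (box a b) x)"
    proof (rule integral_dominated_convergence[where w="\<lambda>x. \<bar>G x\<bar>"])
      show "(\<lambda>x. G x * box_bump (real (Suc n)) a b x) \<in> borel_measurable (lebesgue_on \<Omega>)" for n
        using G \<Omega> continuous_imp_measurable_on_sets_lebesgue[OF continuous_on_subset[OF cont]]
        by (intro borel_measurable_times) auto
      have "indicator (box a b) \<in> borel_measurable (lebesgue_on \<Omega>)"
        using \<Omega> by (intro measurable_restrict_space1 borel_measurable_indicator) auto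
      then show "(\<lambda>x. G x * indicator (box a b) x) \<in> borel_measurable (lebesgue_on \<Omega>)"
        using G by (intro borel_measurable_times) auto
      show "AE x in lebesgue_on \<Omega>. (\<lambda>n. G x * box_bump (real (Suc n)) a b x) \<longlonglongrightarrow> G x * indicator (box a b) x"
        by (intro AE_I2 tendsto_mult tendsto_const box_bump_tendsto_indicator)
      show "AE x in lebesgue_on \<Omega>. norm (G x * box_bump (real (Suc n)) a b x) \<le> \<bar>G x\<bar>" for n
        by (intro AE_I2) (simp add: abs_mult mult_left_le abs_box_bump_le_1 del: of_nat_Suc)
    qed (use G in auto)
    then show ?thesis
      using test[OF bump] by (simp add: LIMSEQ_const_iff)
  qed
  \<comment> \<open>Passes from the Bochner integral against the indicator of an open box to the
    gauge integral over the closed box, the form in which box averages appear in the differentiation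
    theorem.\<close>
  have box: "integral (cbox a b) F = 0" if ab: "cbox a b \<subseteq> \<Omega>" for a b
  proof -
    have "integral (cbox a b) F = integral (box a b) F"
      by (simp add: integral_open_interval)
    also have "\<dots> = integral\<^sup>L (lebesgue_on (box a b)) F"
      by (intro lebesgue_integral_eq_integral[symmetric] F_on) auto
    also have "\<dots> = (LINT x|lebesgue. indicator (box a b) x *\<^sub>R F x)"
      by (simp add: integral_restrict_space)
    also have "\<dots> = (LINT x|lebesgue. indicator \<Omega> x *\<^sub>R (G x * indicator (box a b) x))"
      by (intro Bochner_Integration.integral_cong) (auto simp: F_def indicator_def)
    also have "\<dots> = 0"
      using indicator[OF ab] \<Omega> by (simp add: integral_restrict_space)
    finally show ?thesis .
  qed
  have F_cbox: "F integrable_on cbox a b" for a b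
    by (rule integrable_on_lebesgue_on[OF F_on]) auto
  obtain N where N: "negligible N" and density:
    "\<And>x e. \<lbrakk>x \<notin> N; 0 < e\<rbrakk> \<Longrightarrow> \<exists>d>0. \<forall>h. 0 < h \<and> h < d \<longrightarrow>
      norm (integral (cbox x (x + h *\<^sub>R One)) F /\<^sub>R h ^ DIM(real ^ 'n) - F x) < e"
    by (rule integrable_ccontinuous_explicit[of F, OF F_cbox], rule that)
  have zero: "G x = 0" if "x \<in> \<Omega>" "x \<notin> N" for x
  proof (rule ccontr)
    assume "G x \<noteq> 0"
    then have "0 < \<bar>F x\<bar>"
      using that by (simp add: F_def)
    from density[OF that(2) this] obtain d where d: "d > 0" and close: "\<And>h. 0 < h \<and> h < d \<Longrightarrow>
        norm (integral (cbox x (x + h *\<^sub>R One)) F /\<^sub>R h ^ DIM(real ^ 'n) - F x) < \<bar>F x\<bar>"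
      by blast
    obtain r where r: "r > 0" "cball x r \<subseteq> \<Omega>"
      using \<open>open \<Omega>\<close> \<open>x \<in> \<Omega>\<close> by (meson open_contains_cball)
    \<comment> \<open>Halving \<open>d\<close> makes h < d strict. Dividing \<open>r\<close> by the
      dimension keeps the cube of side h inside the ball, since the Euclidean norm is at most the
      sum of the coordinates' absolute values.\<close>
    define h where "h = min (d / 2) (r / DIM(real ^ 'n))"
    have h: "0 < h" "h < d" "DIM(real ^ 'n) * h \<le> r"
      using d r by (auto simp: h_def min_def field_simps)
    have "cbox x (x + h *\<^sub>R One) \<subseteq> cball x r"
    proof
      fix y assume y: "y \<in> cbox x (x + h *\<^sub>R One)"
      have "norm (y - x) \<le> (\<Sum>b\<in>Basis. \<bar>(y - x) \<bullet> b\<bar>)"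
        by (rule norm_le_l1)
      also have "\<dots> \<le> (\<Sum>b\<in>(Basis :: (real ^ 'n) set). h)"
        using y by (intro sum_mono) (auto simp: mem_box inner_diff_left inner_add_left)
      also have "\<dots> \<le> r"
        using h by simp
      finally show "y \<in> cball x r"
        by (simp add: dist_norm norm_minus_commute)
    qed
    \<comment> \<open>The average over the cube is 0, so the density estimate with tolerance
      \<open>\<bar>F x\<bar>\<close> says that this number is less than itself.\<close>
    then show False
      using close[of h] h(1,2) box[of x "x + h *\<^sub>R One"] r(2) by simp
  qed
  have "AE x in lebesgue. x \<notin> N"
    using N by (simp add: negligible_iff_null_sets AE_not_in)
  then have "AE x in lebesgue. x \<in> \<Omega> \<longrightarrow> G x = 0"
    by (rule eventually_mono) (use zero in blast)
  with \<Omega> show ?thesis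
    by (simp add: AE_restrict_space_iff)
qed

section \<open>Square integrable fields and weak gradients\<close>

lemma integrable_inner_L2_space:
  assumes f: "f \<in> L2_space M" and g: "g \<in> L2_space M"
  shows "integrable M (\<lambda>x. f x \<bullet> g x)"
proof (rule Bochner_Integration.integrable_bound)
  show "integrable M (\<lambda>x. (norm (f x))\<^sup>2 + (norm (g x))\<^sup>2)"
    using assms by (simp add: L2_space_def)
  show "(\<lambda>x. f x \<bullet> g x) \<in> borel_measurable M"
    using assms by (auto simp: L2_space_def intro: borel_measurable_inner)
  have "\<bar>f x \<bullet> g x\<bar> \<le> (norm (f x))\<^sup>2 + (norm (g x))\<^sup>2" for x
    using Cauchy_Schwarz_ineq2[of "f x" "g x"] sum_squares_bound[of "norm (f x)" "norm (g x)"]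
      zero_le_power2[of "norm (f x)"] zero_le_power2[of "norm (g x)"] by argo
  then show "AE x in M. norm (f x \<bullet> g x) \<le> norm ((norm (f x))\<^sup>2 + (norm (g x))\<^sup>2)"
    by (intro AE_I2) simp
qed

lemma L2_space_bounded_linear:
  assumes T: "bounded_linear T" and f: "f \<in> L2_space M"
  shows "(\<lambda>x. T (f x)) \<in> L2_space M"
proof -
  obtain K where K: "\<And>y. norm (T y) \<le> norm y * K"
    using bounded_linear.bounded[OF T] by blast
  have m: "(\<lambda>x. T (f x)) \<in> borel_measurable M"
    using f borel_measurable_continuous_onI[OF linear_continuous_on[OF T]]
    by (auto simp: L2_space_def intro: measurable_compose)
  moreover have "integrable M (\<lambda>x. (norm (T (f x)))\<^sup>2)"
  proof (rule Bochner_Integration.integrable_bound)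
    show "integrable M (\<lambda>x. K\<^sup>2 * (norm (f x))\<^sup>2)"
      using f by (simp add: L2_space_def)
    show "AE x in M. norm ((norm (T (f x)))\<^sup>2) \<le> norm (K\<^sup>2 * (norm (f x))\<^sup>2)"
      using power_mono[OF K, of _ 2] by (intro AE_I2) (simp add: power_mult_distrib mult.commute)
  qed (use m in measurable)
  ultimately show ?thesis
    by (simp add: L2_space_def)
qed

lemma L2_space_add:
  assumes f: "f \<in> L2_space M" and g: "g \<in> L2_space M"
  shows "(\<lambda>x. f x + g x) \<in> L2_space M"
proof -
  have "integrable M (\<lambda>x. (norm (f x))\<^sup>2 + 2 * (f x \<bullet> g x) + (norm (g x))\<^sup>2)"
    using f g integrable_inner_L2_space[OF f g] by (simp add: L2_space_def)
  moreover have "(\<lambda>x. f x + g x) \<in> borel_measurable M"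
    using f g by (auto simp: L2_space_def intro: borel_measurable_add)
  ultimately show ?thesis
    by (simp add: L2_space_def power2_norm_eq_inner inner_add_left inner_add_right
      inner_commute algebra_simps)
qed

lemma L2_space_lincomb:
  "f \<in> L2_space M \<Longrightarrow> g \<in> L2_space M \<Longrightarrow> (\<lambda>x. a *\<^sub>R f x + b *\<^sub>R g x) \<in> L2_space M"
  by (intro L2_space_add L2_space_bounded_linear[OF bounded_linear_scaleR_right])

lemma (in finite_measure) L2_space_bounded:
  assumes "f \<in> borel_measurable M" and "\<And>x. x \<in> space M \<Longrightarrow> norm (f x) \<le> B"
  shows "f \<in> L2_space M"
proof -
  have "integrable M (\<lambda>x. (norm (f x))\<^sup>2)"
    using assms by (intro integrable_const_bound[where B="B\<^sup>2"]) (auto intro!: power_mono AE_I2)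
  with assms show ?thesis
    by (simp add: L2_space_def)
qed

lemma C_0_L2_space:
  fixes \<Omega> :: "(real ^ 'n) set"
  assumes "C_k 0 \<phi>" and "bounded \<Omega>" and "\<Omega> \<in> lmeasurable"
  shows "\<phi> \<in> L2_space (lebesgue_on \<Omega>)"
proof -
  interpret finite_measure "lebesgue_on \<Omega>"
    using assms(3) by (rule finite_measure_lebesgue_on)
  have cont: "continuous_on S \<phi>" for S
    using assms(1) by (auto intro: continuous_on_subset)
  have "compact (\<phi> ` closure \<Omega>)"
    using assms(2) by (intro compact_continuous_image cont) auto
  then obtain B where "\<And>y. y \<in> \<phi> ` closure \<Omega> \<Longrightarrow> norm y \<le> B"
    using compact_imp_bounded bounded_iff by metis
  then have "norm (\<phi> x) \<le> B" if "x \<in> \<Omega>" for x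
    using closure_subset that by blast
  moreover have "\<phi> \<in> borel_measurable (lebesgue_on \<Omega>)"
    using continuous_imp_measurable_on_sets_lebesgue[OF cont] assms(3) by auto
  ultimately show ?thesis
    by (intro L2_space_bounded) auto
qed

lemma L2_space_vec_nth: "f \<in> L2_space M \<Longrightarrow> (\<lambda>x. f x $ i) \<in> L2_space M"
  by (rule L2_space_bounded_linear[OF bounded_linear_vec_nth])

lemma integrable_L2_space_times_C_0:
  fixes \<Omega> :: "(real ^ 'n) set" and h :: "real ^ 'n \<Rightarrow> real"
  assumes "h \<in> L2_space (lebesgue_on \<Omega>)" and "C_k 0 \<phi>" and "bounded \<Omega>" and "\<Omega> \<in> lmeasurable"
  shows "integrable (lebesgue_on \<Omega>) (\<lambda>x. h x * \<phi> x)"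
  using integrable_inner_L2_space[OF assms(1) C_0_L2_space[OF assms(2-4)]] by simp

section \<open>Linearity and uniqueness of weak gradients\<close>

lemma test_functions_C_k: "\<phi> \<in> test_functions \<Omega> \<Longrightarrow> C_k k \<phi>"
  by (simp add: test_functions_def)

lemma test_functions_C_k_partial_deriv:
  "\<phi> \<in> test_functions \<Omega> \<Longrightarrow> C_k k (partial_deriv j \<phi>)"
  using test_functions_C_k[of \<phi> \<Omega> "Suc k"] by simp

text \<open>Splitting the integrals requires each product with a test function or its derivative to
  be integrable. This follows because a continuous function is bounded on the bounded set \<Omega>,
  hence square integrable there.\<close>

lemma has_weak_gradient_lincomb:
  fixes \<Omega> :: "(real ^ 'n) set"
  assumes \<Omega>: "bounded \<Omega>" "\<Omega> \<in> lmeasurable"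
    and L2: "u \<in> L2_space (lebesgue_on \<Omega>)" "v \<in> L2_space (lebesgue_on \<Omega>)"
      "Gu \<in> L2_space (lebesgue_on \<Omega>)" "Gv \<in> L2_space (lebesgue_on \<Omega>)"
    and u: "has_weak_gradient \<Omega> u Gu" and v: "has_weak_gradient \<Omega> v Gv"
  shows "has_weak_gradient \<Omega> (\<lambda>x. a *\<^sub>R u x + b *\<^sub>R v x) (\<lambda>x. a *\<^sub>R Gu x + b *\<^sub>R Gv x)"
  unfolding has_weak_gradient_def
proof (intro ballI allI)
  fix \<phi> i j assume \<phi>: "\<phi> \<in> test_functions \<Omega>"
  note int = integrable_L2_space_times_C_0[OF L2_space_vec_nth _ \<Omega>]
    integrable_L2_space_times_C_0[OF L2_space_vec_nth[OF L2_space_vec_nth] _ \<Omega>]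
  note C_0 = test_functions_C_k[OF \<phi>, of 0] test_functions_C_k_partial_deriv[OF \<phi>, of 0 j]
  have "(LINT x|lebesgue_on \<Omega>. (a *\<^sub>R u x + b *\<^sub>R v x) $ i * partial_deriv j \<phi> x) =
      (LINT x|lebesgue_on \<Omega>. a * (u x $ i * partial_deriv j \<phi> x) + b * (v x $ i * partial_deriv j \<phi> x))"
    by (simp add: algebra_simps)
  also have "\<dots> = a * (LINT x|lebesgue_on \<Omega>. u x $ i * partial_deriv j \<phi> x)
      + b * (LINT x|lebesgue_on \<Omega>. v x $ i * partial_deriv j \<phi> x)"
    by (subst Bochner_Integration.integral_add)
      (auto intro!: integrable_mult_right int L2 C_0)
  also have "\<dots> = - (a * (LINT x|lebesgue_on \<Omega>. Gu x $ i $ j * \<phi> x)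
      + b * (LINT x|lebesgue_on \<Omega>. Gv x $ i $ j * \<phi> x))"
    using u v \<phi> by (simp add: has_weak_gradient_def)
  also have "\<dots> = - (LINT x|lebesgue_on \<Omega>. a * (Gu x $ i $ j * \<phi> x) + b * (Gv x $ i $ j * \<phi> x))"
    by (subst Bochner_Integration.integral_add)
      (auto intro!: integrable_mult_right int L2 C_0)
  also have "\<dots> = - (LINT x|lebesgue_on \<Omega>. (a *\<^sub>R Gu x + b *\<^sub>R Gv x) $ i $ j * \<phi> x)"
    by (simp add: algebra_simps)
  finally show "(LINT x|lebesgue_on \<Omega>. (a *\<^sub>R u x + b *\<^sub>R v x) $ i * partial_deriv j \<phi> x) =
      - (LINT x|lebesgue_on \<Omega>. (a *\<^sub>R Gu x + b *\<^sub>R Gv x) $ i $ j * \<phi> x)" .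
qed

text \<open>Entry by entry, the difference of two weak gradients is orthogonal to all test
  functions. The exceptional null sets of the finitely many entries are then united.\<close>

lemma has_weak_gradient_unique_AE:
  fixes \<Omega> :: "(real ^ 'n) set"
  assumes \<Omega>: "open \<Omega>" "bounded \<Omega>"
    and L2: "G \<in> L2_space (lebesgue_on \<Omega>)" "G' \<in> L2_space (lebesgue_on \<Omega>)"
    and G: "has_weak_gradient \<Omega> v G" and G': "has_weak_gradient \<Omega> v G'"
  shows "AE x in lebesgue_on \<Omega>. G x = G' x"
proof -
  have lm: "\<Omega> \<in> lmeasurable"
    using \<Omega> by (simp add: lmeasurable_open)
  have "AE x in lebesgue_on \<Omega>. G x $ i $ j - G' x $ i $ j = 0" for i j
  proof (rule fundamental_lemma_calculus_of_variations[OF \<Omega>(1)])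
    note L2_ij = L2[THEN L2_space_vec_nth[THEN L2_space_vec_nth]]
    note int = integrable_L2_space_times_C_0[OF _ _ \<Omega>(2) lm]
    \<comment> \<open>Taking the constant 1 as the continuous factor turns square integrability into
      integrability of the entries.\<close>
    have "integrable (lebesgue_on \<Omega>) (\<lambda>x. G x $ i $ j * 1)"
      "integrable (lebesgue_on \<Omega>) (\<lambda>x. G' x $ i $ j * 1)"
      by (intro int L2_ij C_k_const)+
    then show "integrable (lebesgue_on \<Omega>) (\<lambda>x. G x $ i $ j - G' x $ i $ j)"
      by simp
    fix \<phi> assume \<phi>: "\<phi> \<in> test_functions \<Omega>"
    have "(LINT x|lebesgue_on \<Omega>. (G x $ i $ j - G' x $ i $ j) * \<phi> x) =
        (LINT x|lebesgue_on \<Omega>. G x $ i $ j * \<phi> x) - (LINT x|lebesgue_on \<Omega>. G' x $ i $ j * \<phi> x)"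
      unfolding left_diff_distrib
      by (intro Bochner_Integration.integral_diff int L2_ij test_functions_C_k[OF \<phi>])
    also have "\<dots> = 0"
    proof -
      have "- (LINT x|lebesgue_on \<Omega>. G x $ i $ j * \<phi> x) = - (LINT x|lebesgue_on \<Omega>. G' x $ i $ j * \<phi> x)"
        using G[unfolded has_weak_gradient_def, rule_format, OF \<phi>, of i j]
          G'[unfolded has_weak_gradient_def, rule_format, OF \<phi>, of i j] by (rule trans[OF sym])
      then show ?thesis
        by simp
    qed
    finally show "(LINT x|lebesgue_on \<Omega>. (G x $ i $ j - G' x $ i $ j) * \<phi> x) = 0" .
  qed
  then have "AE x in lebesgue_on \<Omega>. \<forall>i j. G x $ i $ j - G' x $ i $ j = 0"
    by (simp add: AE_all_countable)
  then show ?thesis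
    by (rule eventually_mono) (simp add: vec_eq_iff)
qed

lemma weak_gradient:
  assumes "v \<in> H1 \<Omega>"
  shows "weak_gradient \<Omega> v \<in> L2_space (lebesgue_on \<Omega>)"
    and "has_weak_gradient \<Omega> v (weak_gradient \<Omega> v)"
proof -
  have "\<exists>G. G \<in> L2_space (lebesgue_on \<Omega>) \<and> has_weak_gradient \<Omega> v G"
    using assms by (auto simp: H1_def)
  from someI_ex[OF this] show "weak_gradient \<Omega> v \<in> L2_space (lebesgue_on \<Omega>)"
    and "has_weak_gradient \<Omega> v (weak_gradient \<Omega> v)"
    by (simp_all add: weak_gradient_def)
qed

lemma H1_imp_L2_space: "v \<in> H1 \<Omega> \<Longrightarrow> v \<in> L2_space (lebesgue_on \<Omega>)"
  by (simp add: H1_def)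

lemma H1_lincomb:
  fixes \<Omega> :: "(real ^ 'n) set"
  assumes "bounded \<Omega>" and "\<Omega> \<in> lmeasurable" and "u \<in> H1 \<Omega>" and "v \<in> H1 \<Omega>"
  shows "(\<lambda>x. a *\<^sub>R u x + b *\<^sub>R v x) \<in> H1 \<Omega>"
  using has_weak_gradient_lincomb[OF assms(1,2) assms(3,4)[THEN H1_imp_L2_space]
      assms(3,4)[THEN weak_gradient(1)] assms(3,4)[THEN weak_gradient(2)]]
    L2_space_lincomb[OF assms(3,4)[THEN H1_imp_L2_space]]
    L2_space_lincomb[OF assms(3,4)[THEN weak_gradient(1)]]
  unfolding H1_def by blast

text \<open>\<open>weak_gradient\<close> selects a representative separately for each field, so
  linearity is guaranteed only off a null set, by uniqueness.\<close>

lemma sym_gradient_lincomb_AE: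
  fixes \<Omega> :: "(real ^ 'n) set"
  assumes \<Omega>: "open \<Omega>" "bounded \<Omega>" and uv: "u \<in> H1 \<Omega>" "v \<in> H1 \<Omega>"
  shows "AE x in lebesgue_on \<Omega>. sym_gradient \<Omega> (\<lambda>x. a *\<^sub>R u x + b *\<^sub>R v x) x =
    a *\<^sub>R sym_gradient \<Omega> u x + b *\<^sub>R sym_gradient \<Omega> v x"
proof -
  have lm: "\<Omega> \<in> lmeasurable"
    using \<Omega> by (simp add: lmeasurable_open)
  note w = weak_gradient[OF H1_lincomb[OF \<Omega>(2) lm uv, of a b]]
  have "AE x in lebesgue_on \<Omega>. weak_gradient \<Omega> (\<lambda>x. a *\<^sub>R u x + b *\<^sub>R v x) x =
      a *\<^sub>R weak_gradient \<Omega> u x + b *\<^sub>R weak_gradient \<Omega> v x"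
    by (rule has_weak_gradient_unique_AE[OF \<Omega> w(1) _ w(2)])
      (intro L2_space_lincomb has_weak_gradient_lincomb \<Omega> lm uv[THEN H1_imp_L2_space]
        uv[THEN weak_gradient(1)] uv[THEN weak_gradient(2)])+
  then show ?thesis
    by (rule eventually_mono)
      (simp add: sym_gradient_def vec_eq_iff transpose_def algebra_simps)
qed

lemma sym_gradient_symmetric: "transpose (sym_gradient \<Omega> v x) = sym_gradient \<Omega> v x"
  by (simp add: sym_gradient_def vec_eq_iff transpose_def)

lemma sym_gradient_L2_space:
  fixes \<Omega> :: "(real ^ 'n) set"
  assumes "v \<in> H1 \<Omega>"
  shows "sym_gradient \<Omega> v \<in> L2_space (lebesgue_on \<Omega>)"
proof -
  have "linear (\<lambda>A :: real ^ 'n ^ 'n. (1/2) *\<^sub>R (transpose A + A))"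
    by (rule linearI) (simp_all add: vec_eq_iff transpose_def algebra_simps)
  then have "bounded_linear (\<lambda>A :: real ^ 'n ^ 'n. (1/2) *\<^sub>R (transpose A + A))"
    by (simp add: linear_conv_bounded_linear)
  from L2_space_bounded_linear[OF this weak_gradient(1)[OF assms]] show ?thesis
    by (simp add: sym_gradient_def[abs_def])
qed

section \<open>Boundary traces and linearity of the load\<close>

lemma boundary_trace_cases:
  obtains "is_trace_operator \<Omega> (boundary_trace \<Omega>)" | "boundary_trace \<Omega> = (\<lambda>v x. 0)"
  using someI_ex[of "is_trace_operator \<Omega>"] unfolding boundary_trace_def by presburger

text \<open>If \<open>boundary_trace \<Omega>\<close> is a trace operator, its almost everywhere
  linearity passes to the boundary integral; if it is the default zero field, that integral
  vanishes.\<close>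

lemma load_lincomb:
  fixes \<Omega> :: "(real ^ 'n) set"
  assumes \<Omega>: "bounded \<Omega>" "\<Omega> \<in> lmeasurable"
    and f: "f \<in> L2_space (surface_measure \<Omega>)" and g: "g \<in> L2_space (lebesgue_on \<Omega>)"
    and uv: "u \<in> H1 \<Omega>" "v \<in> H1 \<Omega>"
  shows "load \<Omega> f g (\<lambda>x. a *\<^sub>R u x + b *\<^sub>R v x) = a * load \<Omega> f g u + b * load \<Omega> f g v"
proof -
  let ?w = "\<lambda>x. a *\<^sub>R u x + b *\<^sub>R v x" and ?T = "boundary_trace \<Omega>"
  have lin: "(LINT x|M. h x \<bullet> (a *\<^sub>R p x + b *\<^sub>R q x)) = a * (LINT x|M. h x \<bullet> p x) + b * (LINT x|M. h x \<bullet> q x)"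
    if "h \<in> L2_space M" "p \<in> L2_space M" "q \<in> L2_space M"
    for M :: "(real ^ 'n) measure" and h p q :: "real ^ 'n \<Rightarrow> real ^ 'n"
    using integrable_inner_L2_space[OF that(1,2)] integrable_inner_L2_space[OF that(1,3)]
    by (simp add: inner_add_right)
  have "(LINT x|surface_measure \<Omega>. f x \<bullet> ?T ?w x) =
      a * (LINT x|surface_measure \<Omega>. f x \<bullet> ?T u x) + b * (LINT x|surface_measure \<Omega>. f x \<bullet> ?T v x)"
  proof (cases rule: boundary_trace_cases[of \<Omega>])
    case 1
    have L2: "?T z \<in> L2_space (surface_measure \<Omega>)" if "z \<in> H1 \<Omega>" for z
      using 1 that unfolding is_trace_operator_def by blast
    have T_w: "AE x in surface_measure \<Omega>. ?T ?w x = a *\<^sub>R ?T u x + b *\<^sub>R ?T v x"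
      using 1 uv unfolding is_trace_operator_def by blast
    have "(LINT x|surface_measure \<Omega>. f x \<bullet> ?T ?w x) =
        (LINT x|surface_measure \<Omega>. f x \<bullet> (a *\<^sub>R ?T u x + b *\<^sub>R ?T v x))"
    proof (rule integral_cong_AE)
      show "(\<lambda>x. f x \<bullet> ?T ?w x) \<in> borel_measurable (surface_measure \<Omega>)"
        using integrable_inner_L2_space[OF f L2[OF H1_lincomb[OF \<Omega> uv]]] by blast
      show "(\<lambda>x. f x \<bullet> (a *\<^sub>R ?T u x + b *\<^sub>R ?T v x)) \<in> borel_measurable (surface_measure \<Omega>)"
        using integrable_inner_L2_space[OF f L2_space_lincomb[OF uv[THEN L2]]] by blast
      show "AE x in surface_measure \<Omega>. f x \<bullet> ?T ?w x = f x \<bullet> (a *\<^sub>R ?T u x + b *\<^sub>R ?T v x)"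
        using T_w by (rule eventually_mono) simp
    qed
    then show ?thesis
      using lin[OF f uv[THEN L2]] by simp
  qed simp
  then show ?thesis
    using lin[OF g uv[THEN H1_imp_L2_space]] by (simp add: load_def algebra_simps)
qed

section \<open>Quadratic forms and the elastic energy\<close>

lemma frobenius_sq_eq_norm: "frobenius_sq B = (norm B)\<^sup>2"
  unfolding frobenius_sq_def power2_norm_eq_inner trace_def transpose_def matrix_matrix_mult_def inner_vec_def
  by (simp, rule sum.swap)

text \<open>The bracket is the cross term b A B + b B A, written through values of \<open>q\<close>
  alone. For \<open>q = V0 x\<close> these can be integrated in x, whereas the bilinear form is
  merely some witness for each x.\<close>

lemma quadratic_form_add_scaleR:
  assumes "quadratic_form q"
  shows "q (A + s *\<^sub>R B) = q A + s * (q (A + B) - q A - q B) + s\<^sup>2 * q B"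
proof -
  obtain b where "bilinear b" and q: "\<And>A. q A = b A A"
    using assms by (auto simp: quadratic_form_def)
  note bil = bilinear_ladd[OF \<open>bilinear b\<close>] bilinear_radd[OF \<open>bilinear b\<close>]
    bilinear_lmul[OF \<open>bilinear b\<close>] bilinear_rmul[OF \<open>bilinear b\<close>]
  show ?thesis
    by (simp add: q bil algebra_simps power2_eq_square)
qed

text \<open>The convexity defect is exactly t (1 - t) q (B - A), so only the sign of
  \<open>q\<close> in the direction \<open>B - A\<close> matters.\<close>

lemma quadratic_form_convex:
  assumes "quadratic_form q" and nonneg: "0 \<le> q (B - A)" and t: "0 \<le> t" "t \<le> 1"
  shows "q ((1 - t) *\<^sub>R A + t *\<^sub>R B) \<le> (1 - t) * q A + t * q B"
proof -
  have "q ((1 - t) *\<^sub>R A + t *\<^sub>R B) = q (A + t *\<^sub>R (B - A))"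
    by (simp add: algebra_simps)
  also have "\<dots> = (1 - t) * q A + t * q B - t * (1 - t) * q (B - A)"
    by (subst quadratic_form_add_scaleR[OF assms(1)]) (simp add: algebra_simps power2_eq_square)
  also have "\<dots> \<le> (1 - t) * q A + t * q B"
    using nonneg t by simp
  finally show ?thesis .
qed

text \<open>Polarisation expresses the coefficients by values of \<open>q\<close> at fixed matrices.
  For \<open>q = V0 x\<close> they are measurable in x, which yields measurability of
  \<open>V0 x (S x)\<close> for a measurable field \<open>S\<close>.\<close>

lemma quadratic_form_Basis_expansion:
  fixes q :: "'a::euclidean_space \<Rightarrow> real"
  assumes "quadratic_form q"
  shows "q A = (\<Sum>i\<in>Basis. \<Sum>j\<in>Basis. (A \<bullet> i) * (A \<bullet> j) * ((q (i + j) - q i - q j) / 2))"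
proof -
  obtain b where "bilinear b" and q: "\<And>A. q A = b A A"
    using assms by (auto simp: quadratic_form_def)
  note bil = bilinear_ladd[OF \<open>bilinear b\<close>] bilinear_radd[OF \<open>bilinear b\<close>]
    bilinear_lmul[OF \<open>bilinear b\<close>] bilinear_rmul[OF \<open>bilinear b\<close>]
  have "q A = b (\<Sum>i\<in>Basis. (A \<bullet> i) *\<^sub>R i) (\<Sum>j\<in>Basis. (A \<bullet> j) *\<^sub>R j)"
    by (simp add: q euclidean_representation)
  also have "\<dots> = (\<Sum>i\<in>Basis. \<Sum>j\<in>Basis. (A \<bullet> i) * (A \<bullet> j) * b i j)"
    by (simp add: bilinear_sum[OF \<open>bilinear b\<close>] sum.cartesian_product bil mult_ac)
  finally have 1: "q A = (\<Sum>i\<in>Basis. \<Sum>j\<in>Basis. (A \<bullet> i) * (A \<bullet> j) * b i j)" .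
  \<comment> \<open>The bilinear form may be asymmetric, so the double sum is averaged with its
    transposed copy.\<close>
  also have "\<dots> = (\<Sum>i\<in>Basis. \<Sum>j\<in>Basis. (A \<bullet> j) * (A \<bullet> i) * b j i)"
    by (rule sum.swap)
  finally have "q A = (q A + (\<Sum>i\<in>Basis. \<Sum>j\<in>Basis. (A \<bullet> j) * (A \<bullet> i) * b j i)) / 2"
    by simp
  also have "\<dots> = (\<Sum>i\<in>Basis. \<Sum>j\<in>Basis. (A \<bullet> i) * (A \<bullet> j) * ((b i j + b j i) / 2))"
    by (subst 1) (simp add: sum.distrib[symmetric] sum_divide_distrib algebra_simps add_divide_distrib)
  also have "\<dots> = (\<Sum>i\<in>Basis. \<Sum>j\<in>Basis. (A \<bullet> i) * (A \<bullet> j) * ((q (i + j) - q i - q j) / 2))"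
    by (simp add: q bil add.commute)
  finally show ?thesis .
qed

lemma borel_measurable_lebesgue_on_AE:
  fixes f g :: "'a::euclidean_space \<Rightarrow> 'b::euclidean_space"
  assumes S: "S \<in> sets lebesgue" and f: "f \<in> borel_measurable (lebesgue_on S)"
    and eq: "AE x in lebesgue_on S. f x = g x"
  shows "g \<in> borel_measurable (lebesgue_on S)"
proof -
  have "AE x in lebesgue. x \<in> S \<longrightarrow> f x = g x"
    using eq S by (simp add: AE_restrict_space_iff)
  then have "AE x in lebesgue. (if x \<in> S then f x else 0) = (if x \<in> S then g x else 0)"
    by (rule eventually_mono) simp
  from borel_measurable_AE[OF f[folded borel_measurable_if[OF S]] this] show ?thesis
    by (simp add: borel_measurable_if[OF S])
qed

section \<open>Integrability of the energy density\<close>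

lemma elastic_density_nonneg:
  assumes "elastic_density \<Omega> \<alpha> \<gamma> V0" and "0 \<le> \<alpha>"
  shows "AE x in lebesgue_on \<Omega>. quadratic_form (V0 x) \<and> (\<forall>B. transpose B = B \<longrightarrow> 0 \<le> V0 x B)"
proof -
  have "AE x in lebesgue_on \<Omega>. quadratic_form (V0 x) \<and>
      (\<forall>B. transpose B = B \<longrightarrow> \<alpha> * frobenius_sq B \<le> V0 x B \<and> V0 x B \<le> \<gamma> * frobenius_sq B)"
    using assms(1) by (simp add: elastic_density_def)
  then show ?thesis
    by (rule eventually_mono)
      (metis assms(2) frobenius_sq_eq_norm mult_nonneg_nonneg order_trans zero_le_power2)
qed

text \<open>The upper bound on \<open>V0\<close> dominates the integrand by \<gamma> times the
  square of the norm of \<open>S\<close>; it covers symmetric arguments only, hence the condition on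
  \<open>S\<close>. Measurability comes from the basis expansion, valid for almost every x.\<close>

lemma integrable_elastic_density:
  assumes \<Omega>: "\<Omega> \<in> sets lebesgue" and V0: "elastic_density \<Omega> \<alpha> \<gamma> V0" and "0 \<le> \<alpha>"
    and S: "S \<in> L2_space (lebesgue_on \<Omega>)" and sym: "\<And>x. transpose (S x) = S x"
  shows "integrable (lebesgue_on \<Omega>) (\<lambda>x. V0 x (S x))"
proof (rule Bochner_Integration.integrable_bound)
  show "integrable (lebesgue_on \<Omega>) (\<lambda>x. \<gamma> * (norm (S x))\<^sup>2)"
    using S by (simp add: L2_space_def)
  have AE: "AE x in lebesgue_on \<Omega>. quadratic_form (V0 x) \<and>
      (\<forall>B. transpose B = B \<longrightarrow> \<alpha> * frobenius_sq B \<le> V0 x B \<and> V0 x B \<le> \<gamma> * frobenius_sq B)"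
    using V0 by (simp add: elastic_density_def)
  have [measurable]: "S \<in> borel_measurable (lebesgue_on \<Omega>)"
    using S by (simp add: L2_space_def)
  have [measurable]: "(\<lambda>x. V0 x B) \<in> borel_measurable (lebesgue_on \<Omega>)" for B
    using V0 by (simp add: elastic_density_def)
  show "(\<lambda>x. V0 x (S x)) \<in> borel_measurable (lebesgue_on \<Omega>)"
  proof (rule borel_measurable_lebesgue_on_AE[OF \<Omega>])
    show "(\<lambda>x. \<Sum>i\<in>Basis. \<Sum>j\<in>Basis. (S x \<bullet> i) * (S x \<bullet> j) * ((V0 x (i + j) - V0 x i - V0 x j) / 2))
        \<in> borel_measurable (lebesgue_on \<Omega>)"
      by measurable
    show "AE x in lebesgue_on \<Omega>. (\<Sum>i\<in>Basis. \<Sum>j\<in>Basis.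
        (S x \<bullet> i) * (S x \<bullet> j) * ((V0 x (i + j) - V0 x i - V0 x j) / 2)) = V0 x (S x)"
      using AE by (rule eventually_mono) (rule quadratic_form_Basis_expansion[symmetric], blast)
  qed
  show "AE x in lebesgue_on \<Omega>. norm (V0 x (S x)) \<le> norm (\<gamma> * (norm (S x))\<^sup>2)"
    using AE
  proof (rule eventually_mono)
    fix x assume x: "quadratic_form (V0 x) \<and>
      (\<forall>B. transpose B = B \<longrightarrow> \<alpha> * frobenius_sq B \<le> V0 x B \<and> V0 x B \<le> \<gamma> * frobenius_sq B)"
    have "\<alpha> * (norm (S x))\<^sup>2 \<le> V0 x (S x)" "V0 x (S x) \<le> \<gamma> * (norm (S x))\<^sup>2"
      using x sym[of x] by (auto simp: frobenius_sq_eq_norm)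
    moreover have "0 \<le> \<alpha> * (norm (S x))\<^sup>2"
      using \<open>0 \<le> \<alpha>\<close> by simp
    ultimately show "norm (V0 x (S x)) \<le> norm (\<gamma> * (norm (S x))\<^sup>2)"
      unfolding real_norm_def by linarith
  qed
qed

section \<open>Minimising a quadratic polynomial on the half-line\<close>

lemma quadratic_attains_min_nonneg:
  fixes a b c :: real
  assumes nonneg: "\<And>s. 0 \<le> a + b * s + c * s\<^sup>2"
  shows "\<exists>s\<ge>0. \<forall>r\<ge>0. a + b * s + c * s\<^sup>2 \<le> a + b * r + c * r\<^sup>2"
proof -
  have "0 \<le> a"
    using nonneg[of 0] by simp
  have "0 \<le> c"
  proof (rule ccontr)
    assume "\<not> 0 \<le> c"
    \<comment> \<open>Chosen so that the values at \<open>s\<close> and \<open>- s\<close> add up to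
      2 (a + c s^2) = -2, although both are nonnegative.\<close>
    define s where "s = sqrt ((a + 1) / (- c))"
    have "s\<^sup>2 = (a + 1) / (- c)"
      using \<open>\<not> 0 \<le> c\<close> \<open>0 \<le> a\<close> by (simp add: s_def field_simps)
    then have "c * s\<^sup>2 = - a - 1"
      using \<open>\<not> 0 \<le> c\<close> by simp
    with nonneg[of s] nonneg[of "- s"] show False
      by simp
  qed
  then consider "0 \<le> b" | "c = 0" "b < 0" | "0 < c" "b < 0"
    by linarith
  then show ?thesis
  proof cases
    case 1
    with \<open>0 \<le> c\<close> show ?thesis
      by (intro exI[of _ 0]) simp
  next
    case 2
    \<comment> \<open>This case is contradictory: at -(a + 1)/b the affine polynomial equals
      -1.\<close>
    then show ?thesis
      using nonneg[of "- (a + 1) / b"] by simp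
  next
    case 3
    define s where "s = - b / (2 * c)"
    have "b = - 2 * c * s"
      using 3 by (simp add: s_def)
    then have "a + b * r + c * r\<^sup>2 - (a + b * s + c * s\<^sup>2) = c * (r - s)\<^sup>2" for r
      by (simp add: power2_eq_square algebra_simps)
    then have "a + b * s + c * s\<^sup>2 \<le> a + b * r + c * r\<^sup>2" for r
      using \<open>0 < c\<close> by (metis diff_ge_0_iff_ge less_imp_le mult_nonneg_nonneg zero_le_power2)
    moreover have "0 \<le> s"
      using 3 by (simp add: s_def divide_nonpos_pos)
    ultimately show ?thesis
      by blast
  qed
qed

section \<open>Squares of skew matrices in dimension two\<close>

lemma skew_square_2:
  fixes W :: "real ^ 2 ^ 2"
  assumes "transpose W = - W"
  shows "W ** W = - ((W $ 1 $ 2)\<^sup>2 *\<^sub>R mat 1)"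
proof -
  have W: "W $ j $ i = - W $ i $ j" for i j
    using arg_cong[OF assms, of "\<lambda>A. A $ i $ j"] by (simp add: transpose_def)
  have "W $ 1 $ 1 = 0" "W $ 2 $ 2 = 0"
    using W[of 1 1] W[of 2 2] by simp_all
  moreover have "W $ 2 $ 1 = - W $ 1 $ 2"
    by (rule W)
  ultimately show ?thesis
    by (simp add: vec_eq_iff forall_2 matrix_matrix_mult_def sum_2 mat_def power2_eq_square)
qed

text \<open>Every s \<ge> 0 occurs because the off-diagonal entry may be \<open>sqrt s\<close>. The
  arbitrary predicate \<open>P\<close> allows the replacement inside the set whose least element is
  taken.\<close>

lemma skew_squares_2:
  "(\<exists>W :: real ^ 2 ^ 2. transpose W = - W \<and> P (W ** W)) \<longleftrightarrow> (\<exists>s\<ge>0. P (- (s *\<^sub>R mat 1)))"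
proof
  assume "\<exists>W :: real ^ 2 ^ 2. transpose W = - W \<and> P (W ** W)"
  then obtain W :: "real ^ 2 ^ 2" where "transpose W = - W" "P (W ** W)"
    by blast
  then show "\<exists>s\<ge>0. P (- (s *\<^sub>R mat 1))"
    by (intro exI[of _ "(W $ 1 $ 2)\<^sup>2"]) (simp add: skew_square_2)
next
  assume "\<exists>s\<ge>0. P (- (s *\<^sub>R mat 1))"
  then obtain s where s: "0 \<le> s" "P (- (s *\<^sub>R mat 1))"
    by blast
  define W :: "real ^ 2 ^ 2" where "W = vector [vector [0, sqrt s], vector [- sqrt s, 0]]"
  have "transpose W = - W"
    by (simp add: vec_eq_iff forall_2 transpose_def W_def)
  moreover from this have "W ** W = - (s *\<^sub>R mat 1)"
    using s by (simp add: skew_square_2) (simp add: W_def)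
  ultimately show "\<exists>W :: real ^ 2 ^ 2. transpose W = - W \<and> P (W ** W)"
    using s(2) by (intro exI[of _ W]) simp
qed

section \<open>The energy as a function of a scalar shift\<close>

definition shifted_energy ::
    "(real ^ 2) set \<Rightarrow> (real ^ 2 \<Rightarrow> real ^ 2 ^ 2 \<Rightarrow> real) \<Rightarrow> (real ^ 2 \<Rightarrow> real ^ 2 ^ 2) \<Rightarrow> real \<Rightarrow> real" where
  "shifted_energy \<Omega> V0 S s = (LINT x|lebesgue_on \<Omega>. V0 x (S x + s *\<^sub>R mat 1))"

text \<open>The term -(1/2) W^2 runs through (s/2) I with s \<ge> 0; the half-line is invariant
  under rescaling, so the factor 1/2 disappears.\<close>

lemma limit_functional_2:
  "limit_functional \<Omega> V0 \<L> v =
    (LEAST e. \<exists>s\<ge>0. e = shifted_energy \<Omega> V0 (sym_gradient \<Omega> v) s) - \<L> v"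
proof -
  have "(\<exists>W. transpose W = - W \<and>
        e = (LINT x|lebesgue_on \<Omega>. V0 x (sym_gradient \<Omega> v x - (1/2) *\<^sub>R (W ** W)))) \<longleftrightarrow>
      (\<exists>s\<ge>0. e = shifted_energy \<Omega> V0 (sym_gradient \<Omega> v) s)" for e
  proof -
    have "(\<exists>W. transpose W = - W \<and>
        e = (LINT x|lebesgue_on \<Omega>. V0 x (sym_gradient \<Omega> v x - (1/2) *\<^sub>R (W ** W)))) \<longleftrightarrow>
        (\<exists>s\<ge>0. e = shifted_energy \<Omega> V0 (sym_gradient \<Omega> v) (s / 2))"
      using skew_squares_2[of "\<lambda>B. e = (LINT x|lebesgue_on \<Omega>. V0 x (sym_gradient \<Omega> v x - (1/2) *\<^sub>R B))"]
      by (simp add: shifted_energy_def)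
    also have "\<dots> \<longleftrightarrow> (\<exists>s\<ge>0. e = shifted_energy \<Omega> V0 (sym_gradient \<Omega> v) s)"
    proof
      assume "\<exists>s\<ge>0. e = shifted_energy \<Omega> V0 (sym_gradient \<Omega> v) (s / 2)"
      then obtain s where "0 \<le> s" "e = shifted_energy \<Omega> V0 (sym_gradient \<Omega> v) (s / 2)"
        by blast
      then show "\<exists>s\<ge>0. e = shifted_energy \<Omega> V0 (sym_gradient \<Omega> v) s"
        by (intro exI[of _ "s / 2"]) simp
    next
      assume "\<exists>s\<ge>0. e = shifted_energy \<Omega> V0 (sym_gradient \<Omega> v) s"
      then obtain s where "0 \<le> s" "e = shifted_energy \<Omega> V0 (sym_gradient \<Omega> v) s"
        by blast
      then show "\<exists>s\<ge>0. e = shifted_energy \<Omega> V0 (sym_gradient \<Omega> v) (s / 2)"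
        by (intro exI[of _ "2 * s"]) simp
    qed
    finally show ?thesis .
  qed
  then show ?thesis
    by (simp only: limit_functional_def)
qed

lemma L2_space_shift:
  assumes "open \<Omega>" "bounded \<Omega>" and "S \<in> L2_space (lebesgue_on \<Omega>)"
  shows "(\<lambda>x. S x + s *\<^sub>R mat 1) \<in> L2_space (lebesgue_on \<Omega>)"
proof -
  interpret finite_measure "lebesgue_on \<Omega>"
    using assms by (intro finite_measure_lebesgue_on lmeasurable_open)
  show ?thesis
    by (intro L2_space_add assms(3) L2_space_bounded[where B="norm (s *\<^sub>R mat 1)"]) auto
qed

lemma transpose_shift:
  "transpose S = S \<Longrightarrow> transpose (S + s *\<^sub>R mat 1) = S + s *\<^sub>R mat 1"
  by (simp add: vec_eq_iff transpose_def mat_def)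

lemma shifted_energy_attains_min:
  assumes \<Omega>: "open \<Omega>" "bounded \<Omega>" and V0: "elastic_density \<Omega> \<alpha> \<gamma> V0" and "0 \<le> \<alpha>"
    and S: "S \<in> L2_space (lebesgue_on \<Omega>)" and sym: "\<And>x. transpose (S x) = S x"
  shows "\<exists>s\<ge>0. \<forall>r\<ge>0. shifted_energy \<Omega> V0 S s \<le> shifted_energy \<Omega> V0 S r"
proof -
  have leb: "\<Omega> \<in> sets lebesgue"
    using \<Omega> by simp
  note int = integrable_elastic_density[OF leb V0 \<open>0 \<le> \<alpha>\<close>]
  have int_shift: "integrable (lebesgue_on \<Omega>) (\<lambda>x. V0 x (S x + s *\<^sub>R mat 1))" for s
    by (rule int[OF L2_space_shift[OF \<Omega> S]]) (rule transpose_shift[OF sym])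
  have int_0: "integrable (lebesgue_on \<Omega>) (\<lambda>x. V0 x (S x))"
    by (rule int[OF S sym])
  have int_1: "integrable (lebesgue_on \<Omega>) (\<lambda>x. V0 x (S x + mat 1))"
    using int_shift[of 1] by simp
  \<comment> \<open>The identity matrix is the zero field shifted by 1.\<close>
  have int_mat: "integrable (lebesgue_on \<Omega>) (\<lambda>x. V0 x (mat 1))"
    using int[OF L2_space_shift[OF \<Omega>, of "\<lambda>x. 0" 1]]
    by (simp add: L2_space_def transpose_mat)
  define a b c where "a = (LINT x|lebesgue_on \<Omega>. V0 x (S x))"
    and "b = (LINT x|lebesgue_on \<Omega>. V0 x (S x + mat 1) - V0 x (S x) - V0 x (mat 1))"
    and "c = (LINT x|lebesgue_on \<Omega>. V0 x (mat 1))"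
  note AE = elastic_density_nonneg[OF V0 \<open>0 \<le> \<alpha>\<close>]
  have energy: "shifted_energy \<Omega> V0 S s = a + b * s + c * s\<^sup>2" for s
  proof -
    have "shifted_energy \<Omega> V0 S s = (LINT x|lebesgue_on \<Omega>.
        V0 x (S x) + s * (V0 x (S x + mat 1) - V0 x (S x) - V0 x (mat 1)) + s\<^sup>2 * V0 x (mat 1))"
      unfolding shifted_energy_def
    proof (rule integral_cong_AE)
      show "AE x in lebesgue_on \<Omega>. V0 x (S x + s *\<^sub>R mat 1) =
          V0 x (S x) + s * (V0 x (S x + mat 1) - V0 x (S x) - V0 x (mat 1)) + s\<^sup>2 * V0 x (mat 1)"
        using AE by (rule eventually_mono) (rule quadratic_form_add_scaleR, blast)
    qed (use int_shift int_0 int_1 int_mat in measurable)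
    also have "\<dots> = a + b * s + c * s\<^sup>2"
      using int_0 int_1 int_mat by (simp add: a_def b_def c_def algebra_simps)
    finally show ?thesis .
  qed
  \<comment> \<open>Holds for negative s as well, as \<open>quadratic_attains_min_nonneg\<close>
    demands, because every such shift of \<open>S\<close> is still symmetric.\<close>
  have "0 \<le> shifted_energy \<Omega> V0 S s" for s
    unfolding shifted_energy_def
  proof (rule integral_nonneg_AE)
    show "AE x in lebesgue_on \<Omega>. 0 \<le> V0 x (S x + s *\<^sub>R mat 1)"
      using AE by (rule eventually_mono) (simp add: transpose_shift[OF sym])
  qed
  then show ?thesis
    using quadratic_attains_min_nonneg[of a b c] by (simp add: energy)
qed

text \<open>On the reals \<open>LEAST\<close> is informative only when a minimum exists; an attained
  minimum identifies it.\<close>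

lemma LEAST_minimum_value:
  fixes h :: "real \<Rightarrow> real"
  assumes "0 \<le> s" and "\<And>r. 0 \<le> r \<Longrightarrow> h s \<le> h r"
  shows "(LEAST e. \<exists>s\<ge>0. e = h s) = h s"
  using assms by (intro Least_equality) auto

text \<open>Joint convexity holds since the shifted field is linear in the pair of field and shift.
  \<open>C\<close> agrees with the combination only almost everywhere, as it will be the symmetric
  gradient chosen for the combined displacement.\<close>

lemma shifted_energy_convex:
  assumes \<Omega>: "open \<Omega>" "bounded \<Omega>" and V0: "elastic_density \<Omega> \<alpha> \<gamma> V0" and "0 \<le> \<alpha>"
    and A: "A \<in> L2_space (lebesgue_on \<Omega>)" "\<And>x. transpose (A x) = A x"
    and B: "B \<in> L2_space (lebesgue_on \<Omega>)" "\<And>x. transpose (B x) = B x"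
    and C: "C \<in> L2_space (lebesgue_on \<Omega>)" "\<And>x. transpose (C x) = C x"
    and C_eq: "AE x in lebesgue_on \<Omega>. C x = (1 - t) *\<^sub>R A x + t *\<^sub>R B x"
    and t: "0 \<le> t" "t \<le> 1"
  shows "shifted_energy \<Omega> V0 C ((1 - t) * r + t * s)
    \<le> (1 - t) * shifted_energy \<Omega> V0 A r + t * shifted_energy \<Omega> V0 B s"
proof -
  have leb: "\<Omega> \<in> sets lebesgue"
    using \<Omega> by simp
  have int: "integrable (lebesgue_on \<Omega>) (\<lambda>x. V0 x (S x + s *\<^sub>R mat 1))"
    if "S \<in> L2_space (lebesgue_on \<Omega>)" "\<And>x. transpose (S x) = S x" for S s
    by (rule integrable_elastic_density[OF leb V0 \<open>0 \<le> \<alpha>\<close> L2_space_shift[OF \<Omega> that(1)]])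
      (rule transpose_shift[OF that(2)])
  have "shifted_energy \<Omega> V0 C ((1 - t) * r + t * s)
      \<le> (LINT x|lebesgue_on \<Omega>. (1 - t) * V0 x (A x + r *\<^sub>R mat 1) + t * V0 x (B x + s *\<^sub>R mat 1))"
    unfolding shifted_energy_def
  proof (rule integral_mono_AE)
    show "AE x in lebesgue_on \<Omega>. V0 x (C x + ((1 - t) * r + t * s) *\<^sub>R mat 1)
        \<le> (1 - t) * V0 x (A x + r *\<^sub>R mat 1) + t * V0 x (B x + s *\<^sub>R mat 1)"
      using C_eq elastic_density_nonneg[OF V0 \<open>0 \<le> \<alpha>\<close>]
    proof eventually_elim
      case (elim x)
      have "transpose (B x + s *\<^sub>R mat 1 - (A x + r *\<^sub>R mat 1)) = B x + s *\<^sub>R mat 1 - (A x + r *\<^sub>R mat 1)"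
        using transpose_shift[OF A(2), of x r] transpose_shift[OF B(2), of x s]
        by (simp add: vec_eq_iff transpose_def)
      then have "0 \<le> V0 x (B x + s *\<^sub>R mat 1 - (A x + r *\<^sub>R mat 1))"
        using elim by blast
      then have "V0 x ((1 - t) *\<^sub>R (A x + r *\<^sub>R mat 1) + t *\<^sub>R (B x + s *\<^sub>R mat 1))
          \<le> (1 - t) * V0 x (A x + r *\<^sub>R mat 1) + t * V0 x (B x + s *\<^sub>R mat 1)"
        using quadratic_form_convex elim t by blast
      moreover have "(1 - t) *\<^sub>R (A x + r *\<^sub>R mat 1) + t *\<^sub>R (B x + s *\<^sub>R mat 1)
          = C x + ((1 - t) * r + t * s) *\<^sub>R mat 1"
        using elim by (simp add: scaleR_add_left scaleR_add_right)
      ultimately show ?case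
        by simp
    qed
  qed (intro int A B C Bochner_Integration.integrable_add integrable_mult_right)+
  also have "\<dots> = (1 - t) * shifted_energy \<Omega> V0 A r + t * shifted_energy \<Omega> V0 B s"
    using int[OF A] int[OF B] by (simp add: shifted_energy_def)
  finally show ?thesis .
qed

section \<open>Convexity by partial minimisation\<close>

theorem proposition2p1:
  fixes \<Omega> :: "(real ^ 2) set"
    and f g :: "real ^ 2 \<Rightarrow> real ^ 2"
    and V0 :: "real ^ 2 \<Rightarrow> real ^ 2 ^ 2 \<Rightarrow> real"
    and \<alpha> \<gamma> :: real
  assumes "open \<Omega>" and "bounded \<Omega>" and "connected \<Omega>" and "lipschitz_boundary \<Omega>"
    and "f \<in> L2_space (surface_measure \<Omega>)"
    and "g \<in> L2_space (lebesgue_on \<Omega>)"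
    and "equilibrated \<Omega> (load \<Omega> f g)"
    and "0 < \<alpha>" and "\<alpha> \<le> \<gamma>"
    and "elastic_density \<Omega> \<alpha> \<gamma> V0"
  shows "convex_functional_on (H1 \<Omega>) (limit_functional \<Omega> V0 (load \<Omega> f g))"
  unfolding convex_functional_on_def
proof (intro ballI conjI)
  fix u v t assume uv: "u \<in> H1 \<Omega>" "v \<in> H1 \<Omega>" and "t \<in> {0..(1::real)}"
  then have t: "0 \<le> t" "t \<le> 1"
    by auto
  have lm: "\<Omega> \<in> lmeasurable"
    using assms(1,2) by (simp add: lmeasurable_open)
  define w where "w x = (1 - t) *\<^sub>R u x + t *\<^sub>R v x" for x
  have w: "w \<in> H1 \<Omega>"
    unfolding w_def by (rule H1_lincomb[OF assms(2) lm uv])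
  then show "(\<lambda>x. (1 - t) *\<^sub>R u x + t *\<^sub>R v x) \<in> H1 \<Omega>"
    by (simp add: w_def[abs_def])
  let ?\<Phi> = "\<lambda>z. shifted_energy \<Omega> V0 (sym_gradient \<Omega> z)"
  have "0 \<le> \<alpha>"
    using assms(8) by simp
  have min: "\<exists>s\<ge>0. (\<forall>r\<ge>0. ?\<Phi> z s \<le> ?\<Phi> z r) \<and> limit_functional \<Omega> V0 (load \<Omega> f g) z = ?\<Phi> z s - load \<Omega> f g z"
    if z: "z \<in> H1 \<Omega>" for z
  proof -
    obtain s where s: "0 \<le> s" "\<And>r. 0 \<le> r \<Longrightarrow> ?\<Phi> z s \<le> ?\<Phi> z r"
      using shifted_energy_attains_min[OF assms(1,2,10) \<open>0 \<le> \<alpha>\<close>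
        sym_gradient_L2_space[OF z] sym_gradient_symmetric] by blast
    then show ?thesis
      using LEAST_minimum_value[of s "?\<Phi> z", OF s] by (auto simp: limit_functional_2)
  qed
  obtain r where r: "0 \<le> r"
    "limit_functional \<Omega> V0 (load \<Omega> f g) u = ?\<Phi> u r - load \<Omega> f g u"
    using min[OF uv(1)] by blast
  obtain s where s: "0 \<le> s"
    "limit_functional \<Omega> V0 (load \<Omega> f g) v = ?\<Phi> v s - load \<Omega> f g v"
    using min[OF uv(2)] by blast
  \<comment> \<open>The combination of the minimisers for \<open>u\<close> and \<open>v\<close> is
    an admissible shift for \<open>w\<close>. It need not minimise there, so it only bounds the
    minimum from above, which is the direction required.\<close>
  have "0 \<le> (1 - t) * r + t * s"
    using r(1) s(1) t by simp
  then have "limit_functional \<Omega> V0 (load \<Omega> f g) w \<le> ?\<Phi> w ((1 - t) * r + t * s) - load \<Omega> f g w"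
    using min[OF w] by force
  also have "\<dots> \<le> (1 - t) * ?\<Phi> u r + t * ?\<Phi> v s - load \<Omega> f g w"
    using shifted_energy_convex[OF assms(1,2,10) \<open>0 \<le> \<alpha>\<close>
      sym_gradient_L2_space[OF uv(1)] sym_gradient_symmetric
      sym_gradient_L2_space[OF uv(2)] sym_gradient_symmetric
      sym_gradient_L2_space[OF w] sym_gradient_symmetric
      sym_gradient_lincomb_AE[OF assms(1,2) uv, of "1 - t" t, folded w_def] t, of r s]
    by simp
  also have "load \<Omega> f g w = (1 - t) * load \<Omega> f g u + t * load \<Omega> f g v"
    unfolding w_def by (rule load_lincomb[OF assms(2) lm assms(5,6) uv])
  finally show "limit_functional \<Omega> V0 (load \<Omega> f g) (\<lambda>x. (1 - t) *\<^sub>R u x + t *\<^sub>R v x) \<le>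
      (1 - t) * limit_functional \<Omega> V0 (load \<Omega> f g) u + t * limit_functional \<Omega> V0 (load \<Omega> f g) v"
    by (simp add: w_def[abs_def] r(2) s(2) algebra_simps)
qed

end
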